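(* Let $\mathbf{L}\in\mathbf{DQD}$ with $|L|>2$. Then the following are equivalent: (a) $\mathbf{L}$ is a subdirectly irreducible algebra in $\mathbf{JID_1}$; (b) $\mathbf{L}$ is a simple algebra in $\mathbf{JID_1}$; (c) $\mathbf{L}\in\mathbf{JID_1}$ and, for every $x\in L$, if $x\neq 1$ then $x\wedge (x')^*=0$; (d) either $\mathbf{L}$ is isomorphic to one of $\mathbf{D_1},\mathbf{D_2},\mathbf{D_3}$, or $\mathbf{L}\in\mathbf{DSt}$ and, for every $x\in L$, if $x\neq 1$ then $x\wedge (x')^*=0$.
   Context: A semi-Heyting algebra is an algebra $\langle L,\vee,\wedge,\to,0,1\rangle$ such that $\langle L,\vee,\wedge,0,1\rangle$ is a bounded lattice and the identities $x\wedge(x\to y)\approx x\wedge y$, $x\wedge(y\to z)\approx x\wedge[(x\wedge y)\to(x\wedge z)]$, $x\to x\approx 1$ hold; write $x^*:=x\to 0$. A $\mathbf{DQD}$-algebra (dually quasi-De Morgan semi-Heyting algebra) is an algebra $\langle L,\vee,\wedge,\to,{}',0,1\rangle$ whose reduct $\langle L,\vee,\wedge,\to,0,1\rangle$ is a semi-Heyting algebra and which satisfies: $0'\approx 1$ and $1'\approx 0$; $(x\wedge y)'\approx x'\vee y'$; $(x\vee y)''\approx x''\vee y''$; $x''\le x$. $\mathbf{DQD}$ denotes the variety of all $\mathbf{DQD}$-algebras. $\mathbf{DSt}$ is the subvariety of $\mathbf{DQD}$ defined by $x'\wedge x''\approx 0$. $\mathbf{JID}$ is the subvariety of $\mathbf{DQD}$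 defined by $x'\vee(y\to z)\approx(x'\vee y)\to(x'\vee z)$, and $\mathbf{JID_1}$ is the subvariety of $\mathbf{JID}$ defined by $x\wedge x'^{*}\approx (x\wedge x'^{*})'^{*}$ (where $z'^*$ means $(z')^*$); relative to $\mathbf{JID}$ this is equivalent to the level-1 identity $x\wedge x'^*\approx x\wedge x'^*\wedge x'^*{}'^*$. The algebras $\mathbf{D_1},\mathbf{D_2},\mathbf{D_3}$ all have universe $\{0,a,b,1\}$ with the four-element Boolean lattice order ($a,b$ complementary atoms), and $0'=1$, $1'=0$, $a'=a$, $b'=b$. The operation $\to$ is given by listing, for each $x$, the tuple $(x\to 0,\ x\to 1,\ x\to a,\ x\to b)$. In $\mathbf{D_1}$: $x=0$: $(1,0,b,a)$; $x=1$: $(0,1,a,b)$; $x=a$: $(b,a,1,0)$; $x=b$: $(a,b,0,1)$. In $\mathbf{D_2}$: $x=0$: $(1,1,1,1)$; $x=1$: $(0,1,a,b)$; $x=a$: $(b,1,1,b)$; $x=b$: $(a,1,a,1)$. In $\mathbf{D_3}$: $x=0$: $(1,a,1,a)$; $x=1$: $(0,1,a,b)$; $x=a$: $(b,a,1,0)$; $x=b$: $(a,1,a,1)$. *)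

theory Defs
  imports Main
begin

text \<open>
  An algebra is a record of operations whose universe is the whole type \<open>'a\<close>; as \<open>'a\<close> is
  arbitrary, so is the universe. The order is the one determined by the meet.
\<close>

record 'a sh =
  join :: "'a \<Rightarrow> 'a \<Rightarrow> 'a"  (infixl "\<squnion>\<index>" 65)
  meet :: "'a \<Rightarrow> 'a \<Rightarrow> 'a"  (infixl "\<sqinter>\<index>" 70)
  imp  :: "'a \<Rightarrow> 'a \<Rightarrow> 'a"  (infixr "\<rightarrow>\<index>" 60)
  zero :: 'a  ("\<zero>\<index>")
  one  :: 'a  ("\<one>\<index>")

record 'a dqd = "'a sh" +
  prime :: "'a \<Rightarrow> 'a"  ("\<sim>\<index> _" [80] 80)

definition le :: "('a, 'm) sh_scheme \<Rightarrow> 'a \<Rightarrow> 'a \<Rightarrow> bool"  (infix "\<sqsubseteq>\<index>" 50)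
  where "x \<sqsubseteq>\<^bsub>L\<^esub> y \<longleftrightarrow> x \<sqinter>\<^bsub>L\<^esub> y = x"

definition lt :: "('a, 'm) sh_scheme \<Rightarrow> 'a \<Rightarrow> 'a \<Rightarrow> bool"  (infix "\<sqsubset>\<index>" 50)
  where "x \<sqsubset>\<^bsub>L\<^esub> y \<longleftrightarrow> x \<sqsubseteq>\<^bsub>L\<^esub> y \<and> x \<noteq> y"

definition star :: "('a, 'm) sh_scheme \<Rightarrow> 'a \<Rightarrow> 'a"  ("_\<^sup>*\<index>" [1000] 999)
  where "x\<^sup>*\<^bsub>L\<^esub> = x \<rightarrow>\<^bsub>L\<^esub> \<zero>\<^bsub>L\<^esub>"

locale semi_heyting_algebra =
  bounded_lattice "meet L" "le L" "lt L" "join L" "zero L" "one L"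
  for L :: "('a, 'm) sh_scheme" (structure) +
  assumes meet_imp: "x \<sqinter> (x \<rightarrow> y) = x \<sqinter> y"
    and meet_imp_relativize: "x \<sqinter> (y \<rightarrow> z) = x \<sqinter> ((x \<sqinter> y) \<rightarrow> (x \<sqinter> z))"
    and imp_self: "x \<rightarrow> x = \<one>"

locale DQD = semi_heyting_algebra L
  for L :: "'a dqd" (structure) +
  assumes prime_zero: "\<sim> \<zero> = \<one>"
    and prime_one: "\<sim> \<one> = \<zero>"
    and prime_meet: "\<sim> (x \<sqinter> y) = \<sim> x \<squnion> \<sim> y"
    and prime_prime_join: "\<sim> \<sim> (x \<squnion> y) = \<sim> \<sim> x \<squnion> \<sim> \<sim> y"
    and prime_prime_le: "\<sim> \<sim> x \<sqsubseteq> x"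

locale DSt = DQD +
  assumes prime_meet_prime_prime: "\<sim> x \<sqinter> \<sim> \<sim> x = \<zero>"

locale JID = DQD +
  assumes prime_join_imp: "\<sim> x \<squnion> (y \<rightarrow> z) = (\<sim> x \<squnion> y) \<rightarrow> (\<sim> x \<squnion> z)"

locale JID1 = JID +
  assumes level1: "x \<sqinter> (\<sim> x)\<^sup>* = (\<sim> (x \<sqinter> (\<sim> x)\<^sup>*))\<^sup>*"

definition congruence :: "'a dqd \<Rightarrow> ('a \<times> 'a) set \<Rightarrow> bool"
  where "congruence L \<theta> \<longleftrightarrow> equiv UNIV \<theta> \<and>
    (\<forall>x y u v. (x, y) \<in> \<theta> \<longrightarrow> (u, v) \<in> \<theta> \<longrightarrow>
      (x \<squnion>\<^bsub>L\<^esub> u, y \<squnion>\<^bsub>L\<^esub> v) \<in> \<theta> \<and>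
      (x \<sqinter>\<^bsub>L\<^esub> u, y \<sqinter>\<^bsub>L\<^esub> v) \<in> \<theta> \<and>
      (x \<rightarrow>\<^bsub>L\<^esub> u, y \<rightarrow>\<^bsub>L\<^esub> v) \<in> \<theta>) \<and>
    (\<forall>x y. (x, y) \<in> \<theta> \<longrightarrow> (\<sim>\<^bsub>L\<^esub> x, \<sim>\<^bsub>L\<^esub> y) \<in> \<theta>)"

text \<open>
  Simple algebras are required to have at least two elements. Subdirect irreducibility means
  having a monolith, i.e. a least congruence different from the identity; this also
  excludes the one-element algebra.
\<close>

definition simple_algebra :: "'a dqd \<Rightarrow> bool"
  where "simple_algebra L \<longleftrightarrow> (\<exists>x y :: 'a. x \<noteq> y) \<and>
    (\<forall>\<theta>. congruence L \<theta> \<longrightarrow> \<theta> = Id \<or> \<theta> = UNIV)"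

definition subdirectly_irreducible :: "'a dqd \<Rightarrow> bool"
  where "subdirectly_irreducible L \<longleftrightarrow>
    (\<exists>\<mu>. congruence L \<mu> \<and> \<mu> \<noteq> Id \<and> (\<forall>\<theta>. congruence L \<theta> \<longrightarrow> \<theta> \<noteq> Id \<longrightarrow> \<mu> \<subseteq> \<theta>))"

definition isomorphic :: "'a dqd \<Rightarrow> 'b dqd \<Rightarrow> bool"  (infix "\<cong>" 50)
  where "L \<cong> M \<longleftrightarrow> (\<exists>h. bij h \<and>
    (\<forall>x y. h (x \<squnion>\<^bsub>L\<^esub> y) = h x \<squnion>\<^bsub>M\<^esub> h y) \<and>
    (\<forall>x y. h (x \<sqinter>\<^bsub>L\<^esub> y) = h x \<sqinter>\<^bsub>M\<^esub> h y) \<and>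
    (\<forall>x y. h (x \<rightarrow>\<^bsub>L\<^esub> y) = h x \<rightarrow>\<^bsub>M\<^esub> h y) \<and>
    (\<forall>x. h (\<sim>\<^bsub>L\<^esub> x) = \<sim>\<^bsub>M\<^esub> h x) \<and>
    h \<zero>\<^bsub>L\<^esub> = \<zero>\<^bsub>M\<^esub> \<and> h \<one>\<^bsub>L\<^esub> = \<one>\<^bsub>M\<^esub>)"

datatype four = E0 | E1 | Ea | Eb

fun four_join :: "four \<Rightarrow> four \<Rightarrow> four" where
  "four_join E0 y = y"
| "four_join E1 y = E1"
| "four_join Ea y = (if y = E0 \<or> y = Ea then Ea else E1)"
| "four_join Eb y = (if y = E0 \<or> y = Eb then Eb else E1)"

fun four_meet :: "four \<Rightarrow> four \<Rightarrow> four" where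
  "four_meet E0 y = E0"
| "four_meet E1 y = y"
| "four_meet Ea y = (if y = E1 \<or> y = Ea then Ea else E0)"
| "four_meet Eb y = (if y = E1 \<or> y = Eb then Eb else E0)"

fun four_prime :: "four \<Rightarrow> four" where
  "four_prime E0 = E1"
| "four_prime E1 = E0"
| "four_prime Ea = Ea"
| "four_prime Eb = Eb"

text \<open>\<open>row p q r s\<close> is the function \<open>y \<mapsto> x \<rightarrow> y\<close> with values \<open>p, q, r, s\<close> at \<open>0, 1, a, b\<close>.\<close>

fun row :: "four \<Rightarrow> four \<Rightarrow> four \<Rightarrow> four \<Rightarrow> four \<Rightarrow> four" where
  "row p q r s E0 = p"
| "row p q r s E1 = q"
| "row p q r s Ea = r"
| "row p q r s Eb = s"

fun imp1 :: "four \<Rightarrow> four \<Rightarrow> four" where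
  "imp1 E0 = row E1 E0 Eb Ea"
| "imp1 E1 = row E0 E1 Ea Eb"
| "imp1 Ea = row Eb Ea E1 E0"
| "imp1 Eb = row Ea Eb E0 E1"

fun imp2 :: "four \<Rightarrow> four \<Rightarrow> four" where
  "imp2 E0 = row E1 E1 E1 E1"
| "imp2 E1 = row E0 E1 Ea Eb"
| "imp2 Ea = row Eb E1 E1 Eb"
| "imp2 Eb = row Ea E1 Ea E1"

fun imp3 :: "four \<Rightarrow> four \<Rightarrow> four" where
  "imp3 E0 = row E1 Ea E1 Ea"
| "imp3 E1 = row E0 E1 Ea Eb"
| "imp3 Ea = row Eb Ea E1 E0"
| "imp3 Eb = row Ea E1 Ea E1"

definition D1 :: "four dqd" where
  "D1 = \<lparr>join = four_join, meet = four_meet, imp = imp1, zero = E0, one = E1,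
    prime = four_prime\<rparr>"

definition D2 :: "four dqd" where
  "D2 = \<lparr>join = four_join, meet = four_meet, imp = imp2, zero = E0, one = E1,
    prime = four_prime\<rparr>"

definition D3 :: "four dqd" where
  "D3 = \<lparr>join = four_join, meet = four_meet, imp = imp3, zero = E0, one = E1,
    prime = four_prime\<rparr>"

end

theory Submission
  imports Defs
begin

text \<open>
  Write \<open>C\<close> for the condition that \<open>x \<sqinter> (\<sim> x)\<^sup>* = \<zero>\<close> whenever \<open>x \<noteq> \<one>\<close>. The lattice of a semi-Heyting
  algebra is distributive, because \<open>x \<rightarrow> x \<sqinter> y\<close> is a residual of the meet, and \<open>x\<^sup>*\<close> is the
  pseudocomplement of \<open>x\<close>. If \<open>c \<sqinter> \<sim> c = \<zero>\<close>, then \<open>u \<sqinter> c = v \<sqinter> c\<close> defines a congruence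
  \<open>\<theta>\<^sub>c\<close>, and \<open>\<theta>\<^sub>c\<close> is the identity only if \<open>c = \<one>\<close>.

  In \<open>JID\<close>, every \<open>\<sim> x\<close> is complemented by \<open>(\<sim> x)\<^sup>*\<close>. Hence in \<open>JID1\<close> the element
  \<open>a = x \<sqinter> (\<sim> x)\<^sup>*\<close>, which equals \<open>(\<sim> a)\<^sup>*\<close>, is a complement of \<open>\<sim> a\<close>, and \<open>\<theta>\<^sub>a\<close> and
  \<open>\<theta>\<^bsub>\<sim> a\<^esub>\<close> are congruences that meet in the identity. Subdirect irreducibility forces
  \<open>a = \<one>\<close> or \<open>\<sim> a = \<one>\<close>, that is, \<open>x = \<one>\<close> or \<open>a = \<zero>\<close>: this is \<open>C\<close>. Conversely, a congruence
  other than the identity relates some \<open>x \<noteq> \<one>\<close> to \<open>\<one>\<close>, so it relates \<open>x \<sqinter> (\<sim> x)\<^sup>*\<close> to \<open>\<one>\<close>;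
  under \<open>C\<close> it relates \<open>\<zero>\<close> to \<open>\<one>\<close>, and the algebra is simple.

  For an algebra in \<open>JID\<close> with \<open>C\<close>, complementation turns \<open>C\<close> into \<open>x \<sqsubseteq> \<sim> x\<close> for
  \<open>x \<noteq> \<one>\<close>. So every element satisfies \<open>x = \<one>\<close>, \<open>\<sim> x = \<one>\<close> or \<open>\<sim> x = x\<close>. If there is no
  element of the third kind, the algebra lies in \<open>DSt\<close>. If \<open>\<sim> a = a\<close>, then \<open>b = a\<^sup>*\<close> also
  satisfies \<open>\<sim> b = b\<close>, and there are no elements besides \<open>\<zero>\<close>, \<open>\<one>\<close>, \<open>a\<close> and \<open>b\<close>. On a
  four-element Boolean lattice the semi-Heyting implication is determined by \<open>\<zero> \<rightarrow> \<one>\<close>; its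
  values \<open>\<zero>\<close>, \<open>\<one>\<close> give \<open>D1\<close>, \<open>D2\<close>, and \<open>a\<close>, \<open>b\<close> give \<open>D3\<close>, the latter up to
  exchanging the atoms. Conversely, \<open>DSt\<close> and \<open>C\<close> together force \<open>\<sim> x\<close> to be \<open>\<zero>\<close> or
  \<open>\<one>\<close>, and then the \<open>JID1\<close> identities are immediate.
\<close>

section \<open>Semi-Heyting algebras\<close>

context semi_heyting_algebra
begin

lemma le_imp_meet_iff: "z \<sqsubseteq> (x \<rightarrow> x \<sqinter> y) \<longleftrightarrow> z \<sqinter> x \<sqsubseteq> y"
proof
  assume "z \<sqsubseteq> (x \<rightarrow> x \<sqinter> y)"
  then have "z \<sqinter> x \<sqsubseteq> x \<sqinter> (x \<rightarrow> x \<sqinter> y)"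
    by (simp add: le_infI1)
  also have "\<dots> = x \<sqinter> y"
    by (simp add: meet_imp)
  finally show "z \<sqinter> x \<sqsubseteq> y"
    by simp
next
  assume "z \<sqinter> x \<sqsubseteq> y"
  then have "z \<sqinter> (x \<sqinter> y) = z \<sqinter> x"
    by (simp add: inf_absorb1 inf_assoc [symmetric])
  then have "z \<sqinter> (x \<rightarrow> x \<sqinter> y) = z"
    using meet_imp_relativize [of z x "x \<sqinter> y"] by (simp add: imp_self)
  then show "z \<sqsubseteq> (x \<rightarrow> x \<sqinter> y)"
    by (simp add: le_def)
qed

lemma meet_join_distrib: "x \<sqinter> (y \<squnion> z) = (x \<sqinter> y) \<squnion> (x \<sqinter> z)"
proof (rule order.antisym)
  let ?r = "x \<rightarrow> x \<sqinter> ((x \<sqinter> y) \<squnion> (x \<sqinter> z))"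
  have "y \<sqsubseteq> ?r" "z \<sqsubseteq> ?r"
    by (simp_all add: le_imp_meet_iff inf_commute)
  then have "y \<squnion> z \<sqsubseteq> ?r"
    by simp
  then show "x \<sqinter> (y \<squnion> z) \<sqsubseteq> (x \<sqinter> y) \<squnion> (x \<sqinter> z)"
    by (simp add: le_imp_meet_iff inf_commute)
qed (simp add: le_infI2)

end

sublocale semi_heyting_algebra \<subseteq> distrib_lattice "meet L" "le L" "lt L" "join L"
  by unfold_locales (rule distrib_imp1, rule meet_join_distrib)

context semi_heyting_algebra
begin

lemma one_imp: "\<one> \<rightarrow> x = x"
  using meet_imp [of \<one> x] by simp

lemma meet_star: "x \<sqinter> x\<^sup>* = \<zero>"
  by (simp add: star_def meet_imp)

lemma le_star_iff: "y \<sqsubseteq> x\<^sup>* \<longleftrightarrow> y \<sqinter> x = \<zero>"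
  using le_imp_meet_iff [of y x \<zero>] by (simp add: star_def bot_unique)

lemma star_zero: "\<zero>\<^sup>* = \<one>"
  by (simp add: star_def imp_self)

lemma star_one: "\<one>\<^sup>* = \<zero>"
  by (simp add: star_def one_imp)

lemma star_eq_complement:
  fixes x y :: 'a
  assumes "x \<squnion> y = \<one>" and "x \<sqinter> y = \<zero>"
  shows "x\<^sup>* = y"
proof (rule order.antisym)
  have "x\<^sup>* = x\<^sup>* \<sqinter> (x \<squnion> y)"
    by (simp add: assms)
  also have "\<dots> = x\<^sup>* \<sqinter> y"
    by (simp add: inf_sup_distrib1 meet_star inf_commute [of "x\<^sup>*" x])
  finally show "x\<^sup>* \<sqsubseteq> y"
    by (metis inf_le2)
  show "y \<sqsubseteq> x\<^sup>*"
    using assms by (simp add: le_star_iff inf_commute)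
qed

lemma le_of_join_eq_one:
  assumes "c \<squnion> a = \<one>" and "a \<sqinter> b = \<zero>"
  shows "b \<sqsubseteq> c"
proof -
  have "b = b \<sqinter> (c \<squnion> a)"
    by (simp add: assms)
  also have "\<dots> = b \<sqinter> c"
    using assms(2) by (simp add: inf_sup_distrib1 inf_commute [of b a])
  finally show ?thesis
    by (metis inf_le2)
qed

lemma eq_if_meets_eq:
  assumes "a \<squnion> b = \<one>" and "u \<sqinter> a = v \<sqinter> a" and "u \<sqinter> b = v \<sqinter> b"
  shows "u = v"
  by (metis assms inf_sup_distrib1 inf_top_right)

text \<open>
  Relative to two complementary elements the implication splits into components, since
  \<open>a \<sqinter> (y \<rightarrow> z)\<close> depends on \<open>a \<sqinter> y\<close> and \<open>a \<sqinter> z\<close> only.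
\<close>

lemma imp_complements:
  assumes j: "a \<squnion> b = \<one>" and m: "a \<sqinter> b = \<zero>"
  shows "\<zero> \<rightarrow> a = (a \<sqinter> (\<zero> \<rightarrow> \<one>)) \<squnion> b"
    and "a \<rightarrow> \<one> = a \<squnion> (b \<sqinter> (\<zero> \<rightarrow> \<one>))"
    and "a \<rightarrow> b = b \<sqinter> (\<zero> \<rightarrow> \<one>)"
proof -
  have m': "b \<sqinter> a = \<zero>"
    using m by (simp add: inf_commute)
  have a1: "a \<sqinter> (\<zero> \<rightarrow> a) = a \<sqinter> (\<zero> \<rightarrow> \<one>)"
    using meet_imp_relativize [of a \<zero> a] meet_imp_relativize [of a \<zero> \<one>] by simp
  have b1: "b \<sqinter> (\<zero> \<rightarrow> b) = b \<sqinter> (\<zero> \<rightarrow> \<one>)"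
    using meet_imp_relativize [of b \<zero> b] meet_imp_relativize [of b \<zero> \<one>] by simp
  have b0: "b \<sqinter> (\<zero> \<rightarrow> a) = b"
    using meet_imp_relativize [of b \<zero> a] by (simp add: m' imp_self)
  have b2: "b \<sqinter> (a \<rightarrow> \<one>) = b \<sqinter> (\<zero> \<rightarrow> \<one>)"
    using meet_imp_relativize [of b a \<one>] b1 by (simp add: m')
  have b3: "b \<sqinter> (a \<rightarrow> b) = b \<sqinter> (\<zero> \<rightarrow> \<one>)"
    using meet_imp_relativize [of b a b] b1 by (simp add: m')
  have split: "u = (a \<sqinter> u) \<squnion> (b \<sqinter> u)" for u
    using inf_sup_distrib2 [of a b u] j by simp
  show "\<zero> \<rightarrow> a = (a \<sqinter> (\<zero> \<rightarrow> \<one>)) \<squnion> b"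
    using split [of "\<zero> \<rightarrow> a"] by (simp only: a1 b0)
  show "a \<rightarrow> \<one> = a \<squnion> (b \<sqinter> (\<zero> \<rightarrow> \<one>))"
    using split [of "a \<rightarrow> \<one>"] by (simp add: meet_imp b2)
  show "a \<rightarrow> b = b \<sqinter> (\<zero> \<rightarrow> \<one>)"
    using split [of "a \<rightarrow> b"] by (simp add: meet_imp b3 m)
qed

end

section \<open>Congruences and subdirect irreducibility\<close>

text \<open>The relation \<open>\<theta>\<^sub>c\<close> of having the same meet with \<open>c\<close>.\<close>

definition meet_rel :: "('a, 'm) sh_scheme \<Rightarrow> 'a \<Rightarrow> ('a \<times> 'a) set"
  where "meet_rel L c = {(u, v). u \<sqinter>\<^bsub>L\<^esub> c = v \<sqinter>\<^bsub>L\<^esub> c}"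

context DQD
begin

lemma prime_antimono: "x \<sqsubseteq> y \<Longrightarrow> \<sim> y \<sqsubseteq> \<sim> x"
  by (metis inf_absorb1 prime_meet sup_ge2)

lemma congruence_meet_rel:
  assumes c: "c \<sqinter> \<sim> c = \<zero>"
  shows "congruence L (meet_rel L c)"
proof -
  have imp: "(x \<rightarrow> u) \<sqinter> c = (y \<rightarrow> v) \<sqinter> c" if "x \<sqinter> c = y \<sqinter> c" "u \<sqinter> c = v \<sqinter> c" for x y u v
  proof -
    have relativize: "(w \<rightarrow> z) \<sqinter> c = c \<sqinter> ((w \<sqinter> c) \<rightarrow> (z \<sqinter> c))" for w z
      using meet_imp_relativize [of c w z] by (simp only: inf_commute [of c])
    show ?thesis
      by (simp only: relativize that)
  qed
  have prime_meet_eq: "\<sim> x \<sqinter> c = \<sim> (x \<sqinter> c) \<sqinter> c" for x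
  proof -
    have "\<sim> (x \<sqinter> c) \<sqinter> c = (\<sim> x \<sqinter> c) \<squnion> (\<sim> c \<sqinter> c)"
      by (simp only: prime_meet inf_sup_distrib2)
    also have "\<sim> c \<sqinter> c = \<zero>"
      using c by (simp only: inf_commute)
    finally show ?thesis
      by simp
  qed
  have prime: "\<sim> x \<sqinter> c = \<sim> y \<sqinter> c" if "x \<sqinter> c = y \<sqinter> c" for x y
    by (subst (1 2) prime_meet_eq) (simp only: that)
  have meet: "(x \<sqinter> u) \<sqinter> c = (y \<sqinter> v) \<sqinter> c" if "x \<sqinter> c = y \<sqinter> c" "u \<sqinter> c = v \<sqinter> c" for x y u v
  proof -
    have split: "(w \<sqinter> z) \<sqinter> c = (w \<sqinter> c) \<sqinter> (z \<sqinter> c)" for w z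
      by (simp add: inf_commute inf_left_commute)
    show ?thesis
      by (simp only: split that)
  qed
  have equiv: "equiv UNIV (meet_rel L c)"
    by (auto simp: meet_rel_def intro!: equivI refl_onI symI transI)
  have join: "(x \<squnion> u) \<sqinter> c = (y \<squnion> v) \<sqinter> c" if "x \<sqinter> c = y \<sqinter> c" "u \<sqinter> c = v \<sqinter> c" for x y u v
    using that by (simp add: inf_sup_distrib2)
  have mem: "(u, v) \<in> meet_rel L c \<longleftrightarrow> u \<sqinter> c = v \<sqinter> c" for u v
    by (simp add: meet_rel_def)
  show ?thesis
    unfolding congruence_def mem
    by (intro conjI allI impI) (assumption | rule equiv join meet imp prime)+
qed

lemma meet_rel_eq_Id:
  assumes "meet_rel L c = Id"
  shows "c = \<one>"
proof -
  have "(c, \<one>) \<in> meet_rel L c"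
    by (simp add: meet_rel_def)
  then show ?thesis
    using assms by simp
qed

lemma congruence_eq_UNIV:
  assumes "congruence L \<theta>" and "(\<zero>, \<one>) \<in> \<theta>"
  shows "\<theta> = UNIV"
proof -
  have eq: "equiv UNIV \<theta>"
    using assms(1) by (simp add: congruence_def)
  have refl: "(x, x) \<in> \<theta>" for x
    using eq by (auto simp: equiv_def refl_on_def)
  have "(x, \<zero>) \<in> \<theta>" for x
  proof -
    have "(x \<sqinter> \<zero>, x \<sqinter> \<one>) \<in> \<theta>"
      using assms refl [of x] unfolding congruence_def by blast
    then show ?thesis
      using eq by (simp add: equiv_def sym_def)
  qed
  then show ?thesis
    using eq by (auto simp: equiv_def) (meson symD transD)
qed

lemma simple_if_meet_star_prime:
  assumes C: "\<forall>x. x \<noteq> \<one> \<longrightarrow> x \<sqinter> (\<sim> x)\<^sup>* = \<zero>" and nontrivial: "\<exists>x y :: 'a. x \<noteq> y"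
  shows "simple_algebra L"
  unfolding simple_algebra_def
proof (intro conjI allI impI)
  fix \<theta>
  assume cong: "congruence L \<theta>"
  have eq: "equiv UNIV \<theta>"
    using cong by (simp add: congruence_def)
  have refl: "(x, x) \<in> \<theta>" for x
    using eq by (auto simp: equiv_def refl_on_def)
  have imp: "(x \<rightarrow> u, y \<rightarrow> v) \<in> \<theta>" and meet: "(x \<sqinter> u, y \<sqinter> v) \<in> \<theta>"
    if "(x, y) \<in> \<theta>" "(u, v) \<in> \<theta>" for x y u v
    using cong that by (auto simp: congruence_def)
  have prime: "(\<sim> x, \<sim> y) \<in> \<theta>" if "(x, y) \<in> \<theta>" for x y
    using cong that by (auto simp: congruence_def)
  show "\<theta> = Id \<or> \<theta> = UNIV"
  proof (cases "\<theta> = Id")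
    case False
    then obtain x y where xy: "(x, y) \<in> \<theta>" "x \<noteq> y"
      using refl by auto
    have "x \<rightarrow> y \<noteq> \<one> \<or> y \<rightarrow> x \<noteq> \<one>"
      using xy(2) meet_imp [of x y] meet_imp [of y x] by (auto simp: inf_commute)
    moreover have "(x \<rightarrow> y, \<one>) \<in> \<theta>" "(y \<rightarrow> x, \<one>) \<in> \<theta>"
      using imp [OF xy(1) refl [of y]] imp [OF refl [of y] xy(1)] by (simp_all add: imp_self)
    ultimately obtain z where z: "(z, \<one>) \<in> \<theta>" "z \<noteq> \<one>"
      by blast
    have "(z \<sqinter> (\<sim> z)\<^sup>*, \<one> \<sqinter> (\<sim> \<one>)\<^sup>*) \<in> \<theta>"
      unfolding star_def by (intro meet imp prime refl z(1))
    then have "(\<zero>, \<one>) \<in> \<theta>"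
      using C z(2) by (simp add: prime_one star_zero)
    then show ?thesis
      using congruence_eq_UNIV [OF cong] by simp
  qed simp
qed (fact nontrivial)

end

lemma subdirectly_irreducible_if_simple:
  assumes "simple_algebra L"
  shows "subdirectly_irreducible L"
proof -
  have "(UNIV :: ('a \<times> 'a) set) \<noteq> Id"
    using assms by (auto simp: simple_algebra_def)
  moreover have "congruence L UNIV"
    by (auto simp: congruence_def intro!: equivI refl_onI symI transI)
  ultimately show ?thesis
    using assms unfolding simple_algebra_def subdirectly_irreducible_def by blast
qed

lemma (in JID) prime_join_star_prime: "\<sim> x \<squnion> (\<sim> x)\<^sup>* = \<one>"
  using prime_join_imp [of x "\<sim> x" \<zero>] by (simp add: star_def imp_self)

lemma (in JID1) meet_star_prime_if_subdirectly_irreducible: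
  assumes si: "subdirectly_irreducible L" and "x \<noteq> \<one>"
  shows "x \<sqinter> (\<sim> x)\<^sup>* = \<zero>"
proof -
  define a where "a = x \<sqinter> (\<sim> x)\<^sup>*"
  have a: "a = (\<sim> a)\<^sup>*"
    unfolding a_def by (rule level1)
  have meet: "a \<sqinter> \<sim> a = \<zero>"
    using meet_star [of "\<sim> a"] a by (simp add: inf_commute)
  have join: "a \<squnion> \<sim> a = \<one>"
    using prime_join_star_prime [of a] a by (simp add: sup_commute)
  have "\<sim> a \<sqinter> \<sim> \<sim> a \<sqsubseteq> \<sim> a \<sqinter> a"
    using prime_prime_le [of a] by (simp add: le_infI2)
  then have meet': "\<sim> a \<sqinter> \<sim> \<sim> a = \<zero>"
    using meet by (simp add: inf_commute bot_unique)
  have "meet_rel L a \<inter> meet_rel L (\<sim> a) \<subseteq> Id"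
    using eq_if_meets_eq [OF join] by (auto simp: meet_rel_def)
  moreover obtain \<mu> where "congruence L \<mu>" "\<mu> \<noteq> Id"
    and least: "\<And>\<theta>. congruence L \<theta> \<Longrightarrow> \<theta> \<noteq> Id \<Longrightarrow> \<mu> \<subseteq> \<theta>"
    using si unfolding subdirectly_irreducible_def by blast
  moreover from this(1) have "Id \<subseteq> \<mu>"
    by (auto simp: congruence_def equiv_def refl_on_def)
  ultimately have "meet_rel L a = Id \<or> meet_rel L (\<sim> a) = Id"
    using congruence_meet_rel [OF meet] congruence_meet_rel [OF meet'] by blast
  then show ?thesis
  proof
    assume "meet_rel L a = Id"
    then have "x \<sqinter> (\<sim> x)\<^sup>* = \<one>"
      using meet_rel_eq_Id a_def by simp
    then have "\<one> \<sqsubseteq> x"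
      by (metis inf_le1)
    then show ?thesis
      using assms(2) by (simp add: top_unique)
  next
    assume "meet_rel L (\<sim> a) = Id"
    then have "\<sim> a = \<one>"
      by (rule meet_rel_eq_Id)
    then show ?thesis
      using a by (simp add: star_one a_def)
  qed
qed

section \<open>Dually Stone algebras\<close>

lemma (in DSt) JID1_if_meet_star_prime:
  assumes C: "\<forall>x. x \<noteq> \<one> \<longrightarrow> x \<sqinter> (\<sim> x)\<^sup>* = \<zero>"
  shows "JID1 L"
proof -
  \<comment> \<open>Unless \<open>\<sim> x = \<one>\<close>: as \<open>\<sim> \<sim> x\<close> is a complement of \<open>\<sim> x\<close>, condition \<open>C\<close> at \<open>\<sim> x\<close> reads \<open>\<sim> x \<sqinter> \<sim> x = \<zero>\<close>.\<close>
  have two_valued: "\<sim> x = \<zero> \<or> \<sim> x = \<one>" for x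
  proof (cases "\<sim> x = \<one>")
    case False
    have "\<sim> (\<sim> x \<sqinter> \<sim> \<sim> x) = \<one>"
      by (simp add: prime_meet_prime_prime prime_zero)
    then have "\<sim> \<sim> x \<squnion> \<sim> \<sim> \<sim> x = \<one>"
      by (simp add: prime_meet)
    moreover have "\<sim> \<sim> x \<squnion> \<sim> \<sim> \<sim> x \<sqsubseteq> \<sim> \<sim> x \<squnion> \<sim> x"
      using prime_prime_le [of "\<sim> x"] by (simp add: le_supI2)
    ultimately have "\<sim> \<sim> x \<squnion> \<sim> x = \<one>"
      by (simp add: top_unique)
    moreover have "\<sim> \<sim> x \<sqinter> \<sim> x = \<zero>"
      using prime_meet_prime_prime [of x] by (simp add: inf_commute)
    ultimately have "(\<sim> \<sim> x)\<^sup>* = \<sim> x"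
      by (rule star_eq_complement)
    then show ?thesis
      using C False by (metis inf_idem)
  qed simp
  show ?thesis
  proof
    fix x y z
    show "\<sim> x \<squnion> (y \<rightarrow> z) = (\<sim> x \<squnion> y) \<rightarrow> (\<sim> x \<squnion> z)"
      using two_valued [of x] by (auto simp: imp_self)
    show "x \<sqinter> (\<sim> x)\<^sup>* = (\<sim> (x \<sqinter> (\<sim> x)\<^sup>*))\<^sup>*"
      using C by (cases "x = \<one>") (simp_all add: prime_one prime_zero star_one star_zero)
  qed
qed

section \<open>The four-element algebras\<close>

lemma isomorphic_if_hom_from:
  assumes "bij g"
    and "\<And>x y. g (x \<squnion>\<^bsub>M\<^esub> y) = g x \<squnion>\<^bsub>L\<^esub> g y"
    and "\<And>x y. g (x \<sqinter>\<^bsub>M\<^esub> y) = g x \<sqinter>\<^bsub>L\<^esub> g y"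
    and "\<And>x y. g (x \<rightarrow>\<^bsub>M\<^esub> y) = g x \<rightarrow>\<^bsub>L\<^esub> g y"
    and "\<And>x. g (\<sim>\<^bsub>M\<^esub> x) = \<sim>\<^bsub>L\<^esub> g x"
    and "g \<zero>\<^bsub>M\<^esub> = \<zero>\<^bsub>L\<^esub>" and "g \<one>\<^bsub>M\<^esub> = \<one>\<^bsub>L\<^esub>"
  shows "L \<cong> M"
proof -
  have inv: "inv g (g x) = x" "g (inv g y) = y" for x y
    using assms(1) by (simp_all add: bij_is_inj bij_is_surj surj_f_inv_f)
  have swap: "inv g y = x \<longleftrightarrow> y = g x" for x y
    using inv by metis
  have "bij (inv g)"
    using assms(1) by (rule bij_imp_bij_inv)
  then show ?thesis
    unfolding isomorphic_def using assms(2-) inv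
    by (intro exI [of _ "inv g"]) (simp add: swap)
qed

text \<open>
  Transfer of \<open>JID1\<close> and \<open>C\<close> along an isomorphism. Of the two identities only that of
  \<open>JID\<close> is transferred, since in a \<open>DQD\<close>-algebra the level-1 identity follows from \<open>C\<close>.
\<close>

lemma JID1_if_isomorphic:
  assumes "DQD L" and "L \<cong> M"
    and jid: "\<And>x y z. \<sim>\<^bsub>M\<^esub> x \<squnion>\<^bsub>M\<^esub> (y \<rightarrow>\<^bsub>M\<^esub> z) =
      (\<sim>\<^bsub>M\<^esub> x \<squnion>\<^bsub>M\<^esub> y) \<rightarrow>\<^bsub>M\<^esub> (\<sim>\<^bsub>M\<^esub> x \<squnion>\<^bsub>M\<^esub> z)"
    and C: "\<And>x. x \<noteq> \<one>\<^bsub>M\<^esub> \<Longrightarrow> x \<sqinter>\<^bsub>M\<^esub> (\<sim>\<^bsub>M\<^esub> x)\<^sup>*\<^bsub>M\<^esub> = \<zero>\<^bsub>M\<^esub>"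
  shows "JID1 L \<and> (\<forall>x. x \<noteq> \<one>\<^bsub>L\<^esub> \<longrightarrow> x \<sqinter>\<^bsub>L\<^esub> (\<sim>\<^bsub>L\<^esub> x)\<^sup>*\<^bsub>L\<^esub> = \<zero>\<^bsub>L\<^esub>)"
proof -
  interpret DQD L by fact
  obtain h where "bij h"
    and hom: "\<And>x y. h (x \<squnion>\<^bsub>L\<^esub> y) = h x \<squnion>\<^bsub>M\<^esub> h y"
      "\<And>x y. h (x \<sqinter>\<^bsub>L\<^esub> y) = h x \<sqinter>\<^bsub>M\<^esub> h y"
      "\<And>x y. h (x \<rightarrow>\<^bsub>L\<^esub> y) = h x \<rightarrow>\<^bsub>M\<^esub> h y"
      "\<And>x. h (\<sim>\<^bsub>L\<^esub> x) = \<sim>\<^bsub>M\<^esub> h x"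
      "h \<zero>\<^bsub>L\<^esub> = \<zero>\<^bsub>M\<^esub>" "h \<one>\<^bsub>L\<^esub> = \<one>\<^bsub>M\<^esub>"
    using assms(2) unfolding isomorphic_def by blast
  then have inj: "x = y" if "h x = h y" for x y
    using that by (meson bij_is_inj injD)
  have CL: "x \<sqinter>\<^bsub>L\<^esub> (\<sim>\<^bsub>L\<^esub> x)\<^sup>*\<^bsub>L\<^esub> = \<zero>\<^bsub>L\<^esub>" if "x \<noteq> \<one>\<^bsub>L\<^esub>" for x
  proof (rule inj)
    have "h x \<noteq> \<one>\<^bsub>M\<^esub>"
      using that inj [of x "\<one>\<^bsub>L\<^esub>"] hom(6) by auto
    then show "h (x \<sqinter>\<^bsub>L\<^esub> (\<sim>\<^bsub>L\<^esub> x)\<^sup>*\<^bsub>L\<^esub>) = h \<zero>\<^bsub>L\<^esub>"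
      using C [of "h x"] by (simp add: star_def hom)
  qed
  have "JID1 L"
  proof
    fix x y z
    show "\<sim>\<^bsub>L\<^esub> x \<squnion>\<^bsub>L\<^esub> (y \<rightarrow>\<^bsub>L\<^esub> z) = (\<sim>\<^bsub>L\<^esub> x \<squnion>\<^bsub>L\<^esub> y) \<rightarrow>\<^bsub>L\<^esub> (\<sim>\<^bsub>L\<^esub> x \<squnion>\<^bsub>L\<^esub> z)"
      by (rule inj) (simp only: hom jid)
    show "x \<sqinter>\<^bsub>L\<^esub> (\<sim>\<^bsub>L\<^esub> x)\<^sup>*\<^bsub>L\<^esub> = (\<sim>\<^bsub>L\<^esub> (x \<sqinter>\<^bsub>L\<^esub> (\<sim>\<^bsub>L\<^esub> x)\<^sup>*\<^bsub>L\<^esub>))\<^sup>*\<^bsub>L\<^esub>"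
      using CL by (cases "x = \<one>\<^bsub>L\<^esub>") (simp_all add: prime_one prime_zero star_one star_zero)
  qed
  with CL show ?thesis
    by blast
qed

lemma JID1_if_isomorphic_four:
  assumes "DQD L" and "L \<cong> D1 \<or> L \<cong> D2 \<or> L \<cong> D3"
  shows "JID1 L \<and> (\<forall>x. x \<noteq> \<one>\<^bsub>L\<^esub> \<longrightarrow> x \<sqinter>\<^bsub>L\<^esub> (\<sim>\<^bsub>L\<^esub> x)\<^sup>*\<^bsub>L\<^esub> = \<zero>\<^bsub>L\<^esub>)"
  using assms(2)
proof (elim disjE)
  assume "L \<cong> D1"
  with assms(1) show ?thesis
  proof (rule JID1_if_isomorphic)
    show "\<sim>\<^bsub>D1\<^esub> x \<squnion>\<^bsub>D1\<^esub> (y \<rightarrow>\<^bsub>D1\<^esub> z) = (\<sim>\<^bsub>D1\<^esub> x \<squnion>\<^bsub>D1\<^esub> y) \<rightarrow>\<^bsub>D1\<^esub> (\<sim>\<^bsub>D1\<^esub> x \<squnion>\<^bsub>D1\<^esub> z)" for x y z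
      by (cases x; cases y; cases z) (simp_all add: D1_def)
    show "x \<sqinter>\<^bsub>D1\<^esub> (\<sim>\<^bsub>D1\<^esub> x)\<^sup>*\<^bsub>D1\<^esub> = \<zero>\<^bsub>D1\<^esub>" if "x \<noteq> \<one>\<^bsub>D1\<^esub>" for x
      using that by (cases x) (simp_all add: D1_def star_def)
  qed
next
  assume "L \<cong> D2"
  with assms(1) show ?thesis
  proof (rule JID1_if_isomorphic)
    show "\<sim>\<^bsub>D2\<^esub> x \<squnion>\<^bsub>D2\<^esub> (y \<rightarrow>\<^bsub>D2\<^esub> z) = (\<sim>\<^bsub>D2\<^esub> x \<squnion>\<^bsub>D2\<^esub> y) \<rightarrow>\<^bsub>D2\<^esub> (\<sim>\<^bsub>D2\<^esub> x \<squnion>\<^bsub>D2\<^esub> z)" for x y z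
      by (cases x; cases y; cases z) (simp_all add: D2_def)
    show "x \<sqinter>\<^bsub>D2\<^esub> (\<sim>\<^bsub>D2\<^esub> x)\<^sup>*\<^bsub>D2\<^esub> = \<zero>\<^bsub>D2\<^esub>" if "x \<noteq> \<one>\<^bsub>D2\<^esub>" for x
      using that by (cases x) (simp_all add: D2_def star_def)
  qed
next
  assume "L \<cong> D3"
  with assms(1) show ?thesis
  proof (rule JID1_if_isomorphic)
    show "\<sim>\<^bsub>D3\<^esub> x \<squnion>\<^bsub>D3\<^esub> (y \<rightarrow>\<^bsub>D3\<^esub> z) = (\<sim>\<^bsub>D3\<^esub> x \<squnion>\<^bsub>D3\<^esub> y) \<rightarrow>\<^bsub>D3\<^esub> (\<sim>\<^bsub>D3\<^esub> x \<squnion>\<^bsub>D3\<^esub> z)" for x y z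
      by (cases x; cases y; cases z) (simp_all add: D3_def)
    show "x \<sqinter>\<^bsub>D3\<^esub> (\<sim>\<^bsub>D3\<^esub> x)\<^sup>*\<^bsub>D3\<^esub> = \<zero>\<^bsub>D3\<^esub>" if "x \<noteq> \<one>\<^bsub>D3\<^esub>" for x
      using that by (cases x) (simp_all add: D3_def star_def)
  qed
qed

text \<open>
  A \<open>DQD\<close>-algebra on the four-element Boolean lattice with both atoms fixed by \<open>\<sim>\<close> is one of \<open>D1\<close>,
  \<open>D2\<close>, \<open>D3\<close> according to the value of \<open>\<zero> \<rightarrow> \<one>\<close>.
\<close>

lemma (in DQD) isomorphic_four:
  assumes all: "\<And>x. x \<in> {\<zero>, \<one>, a, b}" and distinct: "distinct [\<zero>, \<one>, a, b]"
    and join: "a \<squnion> b = \<one>" and meet: "a \<sqinter> b = \<zero>"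
    and prime: "\<sim> a = a" "\<sim> b = b"
  shows "L \<cong> D1 \<or> L \<cong> D2 \<or> L \<cong> D3"
proof -
  \<comment> \<open>The map sending \<open>Ea\<close> to \<open>p\<close> and \<open>Eb\<close> to \<open>q\<close>; either order of the atoms is needed.\<close>
  define g where "g p q = case_four \<zero> \<one> p q" for p q :: 'a
  have g_values: "g p q E0 = \<zero>" "g p q E1 = \<one>" for p q
    by (simp_all add: g_def)
  have bij: "bij (g p q)" if "{p, q} = {a, b}" for p q
  proof (rule bijI)
    have "{\<zero>, \<one>, p, q} = {\<zero>, \<one>, a, b}"
      using that by blast
    then have "x \<in> {\<zero>, \<one>, p, q}" for x
      using all by simp
    moreover have "{\<zero>, \<one>, p, q} \<subseteq> range (g p q)"
      using range_eqI [of _ "g p q" E0] range_eqI [of _ "g p q" E1]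
        range_eqI [of _ "g p q" Ea] range_eqI [of _ "g p q" Eb] by (simp add: g_def)
    ultimately show "surj (g p q)"
      by blast
    have "distinct [\<zero>, \<one>, p, q]"
      using that distinct by (auto simp: doubleton_eq_iff)
    then show "inj (g p q)"
      by (auto simp: inj_def g_def split: four.splits)
  qed
  have ops: "g p q (four_join x y) = g p q x \<squnion> g p q y"
      "g p q (four_meet x y) = g p q x \<sqinter> g p q y"
      "g p q (four_prime x) = \<sim> g p q x"
    if "{p, q} = {a, b}" for p q x y
  proof -
    have "p \<squnion> q = \<one>" "q \<squnion> p = \<one>" "p \<sqinter> q = \<zero>" "q \<sqinter> p = \<zero>" "\<sim> p = p" "\<sim> q = q"
      using that join meet prime by (auto simp: doubleton_eq_iff sup_commute inf_commute)
    then show "g p q (four_join x y) = g p q x \<squnion> g p q y"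
      "g p q (four_meet x y) = g p q x \<sqinter> g p q y"
      "g p q (four_prime x) = \<sim> g p q x"
      by (cases x; cases y; simp add: g_def prime_one prime_zero)+
  qed
  have imps: "\<zero> \<rightarrow> p = (p \<sqinter> (\<zero> \<rightarrow> \<one>)) \<squnion> q" "\<zero> \<rightarrow> q = (q \<sqinter> (\<zero> \<rightarrow> \<one>)) \<squnion> p"
      "p \<rightarrow> \<one> = p \<squnion> (q \<sqinter> (\<zero> \<rightarrow> \<one>))" "q \<rightarrow> \<one> = q \<squnion> (p \<sqinter> (\<zero> \<rightarrow> \<one>))"
      "p \<rightarrow> q = q \<sqinter> (\<zero> \<rightarrow> \<one>)" "q \<rightarrow> p = p \<sqinter> (\<zero> \<rightarrow> \<one>)"
      "p \<rightarrow> \<zero> = q" "q \<rightarrow> \<zero> = p" "p \<squnion> q = \<one>" "q \<squnion> p = \<one>" "p \<sqinter> q = \<zero>" "q \<sqinter> p = \<zero>"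
    if "{p, q} = {a, b}" for p q
  proof -
    show pq: "p \<squnion> q = \<one>" "q \<squnion> p = \<one>" "p \<sqinter> q = \<zero>" "q \<sqinter> p = \<zero>"
      using that join meet by (auto simp: doubleton_eq_iff sup_commute inf_commute)
    show "\<zero> \<rightarrow> p = (p \<sqinter> (\<zero> \<rightarrow> \<one>)) \<squnion> q" "\<zero> \<rightarrow> q = (q \<sqinter> (\<zero> \<rightarrow> \<one>)) \<squnion> p"
      "p \<rightarrow> \<one> = p \<squnion> (q \<sqinter> (\<zero> \<rightarrow> \<one>))" "q \<rightarrow> \<one> = q \<squnion> (p \<sqinter> (\<zero> \<rightarrow> \<one>))"
      "p \<rightarrow> q = q \<sqinter> (\<zero> \<rightarrow> \<one>)" "q \<rightarrow> p = p \<sqinter> (\<zero> \<rightarrow> \<one>)"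
      using imp_complements [OF pq(1,3)] imp_complements [OF pq(2,4)] by blast+
    show "p \<rightarrow> \<zero> = q" "q \<rightarrow> \<zero> = p"
      using star_eq_complement [OF pq(1,3)] star_eq_complement [OF pq(2,4)]
      by (simp_all add: star_def)
  qed
  have ab: "{a, b} = {a, b}" and ba: "{b, a} = {a, b}"
    by blast+
  consider "\<zero> \<rightarrow> \<one> = \<zero>" | "\<zero> \<rightarrow> \<one> = \<one>" | "\<zero> \<rightarrow> \<one> = a" | "\<zero> \<rightarrow> \<one> = b"
    using all [of "\<zero> \<rightarrow> \<one>"] by blast
  then show ?thesis
  proof cases
    case 1
    have "g a b (imp1 x y) = g a b x \<rightarrow> g a b y" for x y
      by (cases x; cases y) (simp_all add: g_def imps [OF ab] 1 one_imp imp_self)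
    then have "L \<cong> D1"
      by (intro isomorphic_if_hom_from [OF bij [OF ab]]) (simp_all add: D1_def ops [OF ab] g_values)
    then show ?thesis ..
  next
    case 2
    have "g a b (imp2 x y) = g a b x \<rightarrow> g a b y" for x y
      by (cases x; cases y) (simp_all add: g_def imps [OF ab] 2 one_imp imp_self)
    then have "L \<cong> D2"
      by (intro isomorphic_if_hom_from [OF bij [OF ab]]) (simp_all add: D2_def ops [OF ab] g_values)
    then show ?thesis by blast
  next
    case 3
    have "g a b (imp3 x y) = g a b x \<rightarrow> g a b y" for x y
      by (cases x; cases y) (simp_all add: g_def imps [OF ab] 3 one_imp imp_self)
    then have "L \<cong> D3"
      by (intro isomorphic_if_hom_from [OF bij [OF ab]]) (simp_all add: D3_def ops [OF ab] g_values)
    then show ?thesis by blast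
  next
    case 4
    have "g b a (imp3 x y) = g b a x \<rightarrow> g b a y" for x y
      by (cases x; cases y) (simp_all add: g_def imps [OF ba] 4 one_imp imp_self)
    then have "L \<cong> D3"
      by (intro isomorphic_if_hom_from [OF bij [OF ba]]) (simp_all add: D3_def ops [OF ba] g_values)
    then show ?thesis by blast
  qed
qed

section \<open>Algebras that are not dually Stone\<close>

context JID
begin

lemma prime_cases:
  assumes C: "\<forall>x. x \<noteq> \<one> \<longrightarrow> x \<sqinter> (\<sim> x)\<^sup>* = \<zero>"
  shows "x = \<one> \<or> \<sim> x = \<one> \<or> \<sim> x = x"
proof -
  have le_prime: "y \<sqsubseteq> \<sim> y" if "y \<noteq> \<one>" for y
  proof (rule le_of_join_eq_one)
    show "\<sim> y \<squnion> (\<sim> y)\<^sup>* = \<one>"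
      by (rule prime_join_star_prime)
    show "(\<sim> y)\<^sup>* \<sqinter> y = \<zero>"
      using C that by (simp add: inf_commute)
  qed
  show ?thesis
    using le_prime [of x] le_prime [of "\<sim> x"] prime_prime_le [of x]
    by (meson order.antisym order.trans)
qed

lemma DSt_or_isomorphic_four:
  assumes C: "\<forall>x. x \<noteq> \<one> \<longrightarrow> x \<sqinter> (\<sim> x)\<^sup>* = \<zero>"
  shows "(L \<cong> D1 \<or> L \<cong> D2 \<or> L \<cong> D3) \<or> DSt L"
proof (cases "\<exists>x. \<sim> x \<sqinter> \<sim> \<sim> x \<noteq> \<zero>")
  case False
  then have "DSt L"
    by unfold_locales blast
  then show ?thesis ..
next
  case True
  note cases = prime_cases [OF C]
  obtain a where ne: "\<sim> a \<sqinter> \<sim> \<sim> a \<noteq> \<zero>"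
    using True by blast
  then have "a \<noteq> \<one>" "\<sim> a \<noteq> \<one>"
    by (auto simp: prime_one)
  then have a: "\<sim> a = a"
    using cases [of a] by blast
  have "a \<noteq> \<zero>"
    using \<open>\<sim> a \<noteq> \<one>\<close> prime_zero by auto
  define b where "b = a\<^sup>*"
  have join: "a \<squnion> b = \<one>"
    using prime_join_star_prime [of a] by (simp add: a b_def)
  have meet: "a \<sqinter> b = \<zero>"
    by (simp add: b_def meet_star)
  have "b \<noteq> \<one>" "b \<noteq> \<zero>" "a \<noteq> b"
    using join meet \<open>a \<noteq> \<zero>\<close> \<open>a \<noteq> \<one>\<close> by auto
  have "\<sim> b \<noteq> \<one>"
  proof
    assume "\<sim> b = \<one>"
    then have "\<sim> \<sim> (a \<squnion> b) = a"
      unfolding prime_prime_join by (simp add: a prime_one)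
    then show False
      using \<open>a \<noteq> \<one>\<close> by (simp add: join prime_one prime_zero)
  qed
  then have b: "\<sim> b = b"
    using cases [of b] \<open>b \<noteq> \<one>\<close> by blast
  have fixed: "c = a \<or> c = b" if c: "\<sim> c = c" for c
  proof -
    have eqI: "c = p" if "p \<sqsubseteq> c" "\<sim> p = p" for p
      using prime_antimono [OF that(1)] that c by (simp add: order.antisym)
    \<comment> \<open>Applying the trichotomy to \<open>c \<sqinter> a\<close>, whose image under \<open>\<sim>\<close> is \<open>c \<squnion> a\<close>.\<close>
    have prime_meet_a: "\<sim> (c \<sqinter> a) = c \<squnion> a"
      by (simp add: prime_meet a c)
    consider "c \<sqinter> a = \<one>" | "c \<squnion> a = \<one>" | "c \<squnion> a = c \<sqinter> a"
      using cases [of "c \<sqinter> a"] unfolding prime_meet_a by blast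
    then show ?thesis
    proof cases
      case 1
      then show ?thesis
        using \<open>a \<noteq> \<one>\<close> by (metis inf_le2 top_unique)
    next
      case 2
      then show ?thesis
        using eqI [OF le_of_join_eq_one [OF _ meet] b] by blast
    next
      case 3
      then have "a \<sqsubseteq> c"
        by (metis inf_le1 order.trans sup_ge2)
      then show ?thesis
        using eqI [OF _ a] by blast
    qed
  qed
  have "c = \<zero>" if c: "\<sim> c = \<one>" for c
  proof -
    have le: "c \<sqsubseteq> p" if p: "\<sim> p = p" "p \<noteq> \<zero>" "p \<noteq> \<one>" for p
    proof -
      \<comment> \<open>This value leaves only the third alternative of the trichotomy for \<open>c \<squnion> p\<close>.\<close>
      have pp: "\<sim> \<sim> (c \<squnion> p) = p"
        unfolding prime_prime_join by (simp add: c p prime_one)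
      then have "c \<squnion> p \<noteq> \<one>" "\<sim> (c \<squnion> p) \<noteq> \<one>"
        using p by (auto simp: prime_one prime_zero)
      then have "\<sim> (c \<squnion> p) = c \<squnion> p"
        using cases [of "c \<squnion> p"] by blast
      with pp have "c \<squnion> p = p"
        by simp
      then show ?thesis
        by (metis sup_ge1)
    qed
    have "c \<sqsubseteq> a \<sqinter> b"
      using le [OF a] le [OF b] \<open>a \<noteq> \<zero>\<close> \<open>a \<noteq> \<one>\<close> \<open>b \<noteq> \<zero>\<close> \<open>b \<noteq> \<one>\<close> by simp
    then show ?thesis
      by (simp add: meet bot_unique)
  qed
  then have "c \<in> {\<zero>, \<one>, a, b}" for c
    using cases [of c] fixed [of c] by blast
  moreover have "distinct [\<zero>, \<one>, a, b]"
    using \<open>a \<noteq> \<zero>\<close> \<open>a \<noteq> \<one>\<close> \<open>b \<noteq> \<zero>\<close> \<open>b \<noteq> \<one>\<close> \<open>a \<noteq> b\<close> \<open>\<sim> a \<noteq> \<one>\<close>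
    by (auto dest: sym) (metis bot_least top_unique order.antisym top_greatest)
  ultimately show ?thesis
    using isomorphic_four [OF _ _ join meet a b] by blast
qed

end

section \<open>The characterisation\<close>

theorem theorem5p9:
  fixes L :: "'a dqd"
  assumes "DQD L"
    and "infinite (UNIV :: 'a set) \<or> card (UNIV :: 'a set) > 2"
  shows "(JID1 L \<and> subdirectly_irreducible L \<longleftrightarrow> JID1 L \<and> simple_algebra L) \<and>
    (JID1 L \<and> simple_algebra L \<longleftrightarrow>
      JID1 L \<and> (\<forall>x. x \<noteq> \<one>\<^bsub>L\<^esub> \<longrightarrow> x \<sqinter>\<^bsub>L\<^esub> (\<sim>\<^bsub>L\<^esub> x)\<^sup>*\<^bsub>L\<^esub> = \<zero>\<^bsub>L\<^esub>)) \<and>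
    (JID1 L \<and> (\<forall>x. x \<noteq> \<one>\<^bsub>L\<^esub> \<longrightarrow> x \<sqinter>\<^bsub>L\<^esub> (\<sim>\<^bsub>L\<^esub> x)\<^sup>*\<^bsub>L\<^esub> = \<zero>\<^bsub>L\<^esub>) \<longleftrightarrow>
      (L \<cong> D1 \<or> L \<cong> D2 \<or> L \<cong> D3) \<or>
      (DSt L \<and> (\<forall>x. x \<noteq> \<one>\<^bsub>L\<^esub> \<longrightarrow> x \<sqinter>\<^bsub>L\<^esub> (\<sim>\<^bsub>L\<^esub> x)\<^sup>*\<^bsub>L\<^esub> = \<zero>\<^bsub>L\<^esub>)))"
proof -
  let ?C = "\<forall>x. x \<noteq> \<one>\<^bsub>L\<^esub> \<longrightarrow> x \<sqinter>\<^bsub>L\<^esub> (\<sim>\<^bsub>L\<^esub> x)\<^sup>*\<^bsub>L\<^esub> = \<zero>\<^bsub>L\<^esub>"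
  have nontrivial: "\<exists>x y :: 'a. x \<noteq> y"
  proof (rule ccontr)
    assume "\<not> ?thesis"
    then have UNIV: "(UNIV :: 'a set) = {undefined}"
      by auto
    show False
      using assms(2) unfolding UNIV by simp
  qed
  have "?C" if "JID1 L" "subdirectly_irreducible L"
    using JID1.meet_star_prime_if_subdirectly_irreducible [OF that] by blast
  moreover have "simple_algebra L" if "?C"
    using DQD.simple_if_meet_star_prime [OF assms(1) that nontrivial] .
  moreover have "(L \<cong> D1 \<or> L \<cong> D2 \<or> L \<cong> D3) \<or> DSt L" if "JID1 L" "?C"
    using JID.DSt_or_isomorphic_four [OF JID1.axioms(1) [OF that(1)] that(2)] .
  moreover have "JID1 L \<and> ?C" if "L \<cong> D1 \<or> L \<cong> D2 \<or> L \<cong> D3"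
    using JID1_if_isomorphic_four [OF assms(1) that] .
  moreover have "JID1 L" if "DSt L" "?C"
    using DSt.JID1_if_meet_star_prime [OF that] .
  ultimately show ?thesis
    using subdirectly_irreducible_if_simple [of L] by blast
qed

end
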